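(* Let $(D,\sqcap,\sqcup,\neg,\top,\bot)$ be a Boolean algebra (meet $\sqcap$, join $\sqcup$, complement $\neg$). Setting $\lrcorner a:=\neg a$ for all $a\in D$, the algebra $(D,\sqcup,\sqcap,\neg,\lrcorner,\top,\bot)$ is a double Boolean algebra which is both fully contextual and pure. Conversely, if $\mathbf D=(D,\sqcup,\sqcap,\neg,\lrcorner,\top,\bot)$ is a double Boolean algebra such that $\neg a=\lrcorner a$ and $\neg\neg a=a$ for all $a\in D$, then $(D,\sqcap,\sqcup,\neg,\top,\bot)$ is a Boolean algebra.
   Context: A double Boolean algebra (dBa) is an algebra $\mathbf{D}=(D,\sqcup,\sqcap,\neg,\lrcorner,\top,\bot)$ of type $(2,2,1,1,0,0)$ such that, with $x\vee y:=\neg(\neg x\sqcap\neg y)$ and $x\wedge y:=\lrcorner(\lrcorner x\sqcup\lrcorner y)$, for all $x,y,z\in D$: $(x\sqcap x)\sqcap y=x\sqcap y$; $x\sqcap y=y\sqcap x$; $x\sqcap(y\sqcap z)=(x\sqcap y)\sqcap z$; $\neg(x\sqcap x)=\neg x$; $x\sqcap(x\sqcup y)=x\sqcap x$; $x\sqcap(y\vee z)=(x\sqcap y)\vee(x\sqcap z)$; $x\sqcap(x\vee y)=x\sqcap x$; $\neg\neg(x\sqcap y)=x\sqcap y$; $x\sqcap\neg x=\bot$; $\neg\bot=\top\sqcap\top$; $\neg\top=\bot$; the duals $(x\sqcup x)\sqcup y=x\sqcup y$; $x\sqcup y=y\sqcup x$; $x\sqcup(y\sqcup z)=(x\sqcup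 y)\sqcup z$; $\lrcorner(x\sqcup x)=\lrcorner x$; $x\sqcup(x\sqcap y)=x\sqcup x$; $x\sqcup(y\wedge z)=(x\sqcup y)\wedge(x\sqcup z)$; $x\sqcup(x\wedge y)=x\sqcup x$; $\lrcorner\lrcorner(x\sqcup y)=x\sqcup y$; $x\sqcup\lrcorner x=\top$; $\lrcorner\top=\bot\sqcup\bot$; $\lrcorner\bot=\top$; and $(x\sqcap x)\sqcup(x\sqcap x)=(x\sqcup x)\sqcap(x\sqcup x)$. The quasi-order is $x\sqsubseteq y$ iff $x\sqcap y=x\sqcap x$ and $x\sqcup y=y\sqcup y$. $x_\sqcap:=x\sqcap x$, $x_\sqcup:=x\sqcup x$, $D_\sqcap:=\{x:x_\sqcap=x\}$, $D_\sqcup:=\{x:x_\sqcup=x\}$. $\mathbf D$ is pure if every $x$ satisfies $x_\sqcap=x$ or $x_\sqcup=x$; fully contextual if $\sqsubseteq$ is a partial order and for all $y\in D_\sqcap$, $x\in D_\sqcup$ with $y_\sqcup=x_\sqcap$ there is a unique $z\in D$ with $z_\sqcap=y$ and $z_\sqcup=x$. *)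

theory Defs
  imports Main
begin

text \<open>
  The carrier of an algebra is the universe of the type \<open>'a\<close>, as in the library locale
  \<open>abstract_boolean_algebra\<close>. The operations \<open>\<sqinter>\<close> and \<open>\<squnion>\<close> need not be idempotent, so they are
  in general different from \<open>\<curlywedge>\<close> and \<open>\<curlyvee>\<close>, which stand for the derived operations
  \<open>x \<and> y\<close> and \<open>x \<or> y\<close>; \<open>opp\<close> is the second negation \<open>\<lrcorner>\<close>.
\<close>

locale double_boolean_signature =
  fixes join :: "'a \<Rightarrow> 'a \<Rightarrow> 'a"  (infixl "\<squnion>" 65)
    and meet :: "'a \<Rightarrow> 'a \<Rightarrow> 'a"  (infixl "\<sqinter>" 70)
    and neg :: "'a \<Rightarrow> 'a"
    and opp :: "'a \<Rightarrow> 'a"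
    and Top :: "'a"
    and Bot :: "'a"
begin

definition vee :: "'a \<Rightarrow> 'a \<Rightarrow> 'a"  (infixl "\<curlyvee>" 65)
  where "x \<curlyvee> y = neg (neg x \<sqinter> neg y)"

definition wedge :: "'a \<Rightarrow> 'a \<Rightarrow> 'a"  (infixl "\<curlywedge>" 70)
  where "x \<curlywedge> y = opp (opp x \<squnion> opp y)"

definition qle :: "'a \<Rightarrow> 'a \<Rightarrow> bool"  (infix "\<sqsubseteq>" 50)
  where "x \<sqsubseteq> y \<longleftrightarrow> x \<sqinter> y = x \<sqinter> x \<and> x \<squnion> y = y \<squnion> y"

definition meet_part :: "'a \<Rightarrow> 'a"
  where "meet_part x = x \<sqinter> x"

definition join_part :: "'a \<Rightarrow> 'a"
  where "join_part x = x \<squnion> x"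

definition D_meet :: "'a set"
  where "D_meet = {x. meet_part x = x}"

definition D_join :: "'a set"
  where "D_join = {x. join_part x = x}"

end

locale double_boolean_algebra = double_boolean_signature +
  assumes meet_idem_left: "(x \<sqinter> x) \<sqinter> y = x \<sqinter> y"
    and meet_commute: "x \<sqinter> y = y \<sqinter> x"
    and meet_assoc: "x \<sqinter> (y \<sqinter> z) = (x \<sqinter> y) \<sqinter> z"
    and neg_meet_idem: "neg (x \<sqinter> x) = neg x"
    and meet_join_absorb: "x \<sqinter> (x \<squnion> y) = x \<sqinter> x"
    and meet_vee_distrib: "x \<sqinter> (y \<curlyvee> z) = (x \<sqinter> y) \<curlyvee> (x \<sqinter> z)"
    and meet_vee_absorb: "x \<sqinter> (x \<curlyvee> y) = x \<sqinter> x"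
    and neg_neg_meet: "neg (neg (x \<sqinter> y)) = x \<sqinter> y"
    and meet_neg: "x \<sqinter> neg x = Bot"
    and neg_Bot: "neg Bot = Top \<sqinter> Top"
    and neg_Top: "neg Top = Bot"
    and join_idem_left: "(x \<squnion> x) \<squnion> y = x \<squnion> y"
    and join_commute: "x \<squnion> y = y \<squnion> x"
    and join_assoc: "x \<squnion> (y \<squnion> z) = (x \<squnion> y) \<squnion> z"
    and opp_join_idem: "opp (x \<squnion> x) = opp x"
    and join_meet_absorb: "x \<squnion> (x \<sqinter> y) = x \<squnion> x"
    and join_wedge_distrib: "x \<squnion> (y \<curlywedge> z) = (x \<squnion> y) \<curlywedge> (x \<squnion> z)"
    and join_wedge_absorb: "x \<squnion> (x \<curlywedge> y) = x \<squnion> x"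
    and opp_opp_join: "opp (opp (x \<squnion> y)) = x \<squnion> y"
    and join_opp: "x \<squnion> opp x = Top"
    and opp_Top: "opp Top = Bot \<squnion> Bot"
    and opp_Bot: "opp Bot = Top"
    and meet_join_idem: "(x \<sqinter> x) \<squnion> (x \<sqinter> x) = (x \<squnion> x) \<sqinter> (x \<squnion> x)"

locale pure_double_boolean_algebra = double_boolean_algebra +
  assumes pure: "meet_part x = x \<or> join_part x = x"

locale fully_contextual_double_boolean_algebra = double_boolean_algebra +
  assumes qle_partial_order: "partial_order_on UNIV {(x, y). x \<sqsubseteq> y}"
    and unique_glueing:
      "\<lbrakk>y \<in> D_meet; x \<in> D_join; join_part y = meet_part x\<rbrakk>
        \<Longrightarrow> \<exists>!z. meet_part z = y \<and> join_part z = x"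

end

theory Submission
  imports Defs
begin

text \<open>
  In every double Boolean algebra \<open>\<not>\<not>x = x\<^sub>\<sqinter>\<close>, and dually for \<open>\<lrcorner>\<close>, so the two negations are
  involutive exactly if \<open>\<sqinter>\<close> and \<open>\<squnion>\<close> are idempotent.  The key identity is
  \<open>(x \<or> y)\<^sub>\<squnion> = x\<^sub>\<sqinter> \<squnion> y\<^sub>\<sqinter>\<close>: it identifies \<open>\<or>\<close> with \<open>\<squnion>\<close> (and dually \<open>\<and>\<close> with \<open>\<sqinter>\<close>) in the
  idempotent case, where the laws of a double Boolean algebra thus become those of a Boolean
  algebra.  Idempotency also makes \<open>x \<mapsto> (x\<^sub>\<sqinter>, x\<^sub>\<squnion>)\<close> injective, which is antisymmetry of \<open>\<sqsubseteq>\<close>.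
\<close>

context double_boolean_algebra
begin

lemma neg_neg: "neg (neg x) = meet_part x"
  by (metis meet_part_def neg_meet_idem neg_neg_meet)

lemma meet_Top: "x \<sqinter> Top = meet_part x"
  unfolding meet_part_def using meet_join_absorb[of x "opp x"] by (simp only: join_opp)

lemma join_part_join: "join_part (x \<squnion> y) = x \<squnion> y"
  by (metis join_part_def opp_join_idem opp_opp_join)

lemma vee_commute: "x \<curlyvee> y = y \<curlyvee> x"
  by (simp add: vee_def meet_commute)

lemma vee_join_meet_part: "(x \<curlyvee> y) \<squnion> meet_part x = join_part (x \<curlyvee> y)"
  using join_meet_absorb[of "x \<curlyvee> y" x]
  by (simp add: meet_commute meet_vee_absorb meet_part_def join_part_def)

lemma meet_part_join_meet: "(meet_part x \<squnion> y) \<sqinter> x = meet_part x"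
  by (metis meet_commute meet_idem_left meet_join_absorb meet_part_def)

lemma join_part_vee: "join_part (x \<curlyvee> y) = meet_part x \<squnion> meet_part y"
proof -
  define s where "s = meet_part x \<squnion> meet_part y"
  have "(x \<curlyvee> y) \<squnion> s = join_part (x \<curlyvee> y) \<squnion> meet_part y"
    by (simp add: s_def join_assoc vee_join_meet_part)
  also have "\<dots> = join_part (x \<curlyvee> y)"
    using vee_join_meet_part[of y x] by (simp add: join_part_def join_idem_left vee_commute)
  finally have "join_part (x \<curlyvee> y) = s \<squnion> (x \<curlyvee> y)"
    by (simp add: join_commute)
  moreover have "s \<sqinter> (x \<curlyvee> y) = x \<curlyvee> y"
  proof -
    have "s \<sqinter> (x \<curlyvee> y) = (s \<sqinter> x) \<curlyvee> (s \<sqinter> y)"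
      by (fact meet_vee_distrib)
    also have "\<dots> = meet_part x \<curlyvee> meet_part y"
      by (metis s_def join_commute meet_part_join_meet)
    also have "\<dots> = x \<curlyvee> y"
      by (simp add: vee_def meet_part_def neg_meet_idem)
    finally show ?thesis .
  qed
  ultimately have "join_part (x \<curlyvee> y) = join_part s"
    using join_meet_absorb[of s "x \<curlyvee> y"] by (simp add: join_part_def)
  then show ?thesis
    by (simp add: s_def join_part_join)
qed

lemma meet_eq_meet_part_trans:
  assumes "x \<sqinter> y = meet_part x" and "y \<sqinter> z = meet_part y"
  shows "x \<sqinter> z = meet_part x"
proof -
  have "x \<sqinter> z = (x \<sqinter> y) \<sqinter> z"
    using assms(1) by (simp add: meet_part_def meet_idem_left)
  also have "\<dots> = x \<sqinter> meet_part y"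
    using assms(2) by (simp flip: meet_assoc)
  also have "\<dots> = x \<sqinter> y"
    by (metis meet_commute meet_idem_left meet_part_def)
  finally show ?thesis
    using assms(1) by simp
qed

lemma meet_eq_meet_part_antisym_iff:
  "x \<sqinter> y = meet_part x \<and> y \<sqinter> x = meet_part y \<longleftrightarrow> meet_part x = meet_part y"
  by (metis meet_commute meet_idem_left meet_part_def)

end

context double_boolean_signature
begin

lemma vee_dual: "double_boolean_signature.vee (\<squnion>) opp = (\<curlywedge>)"
  by (simp add: fun_eq_iff wedge_def double_boolean_signature.vee_def)

lemma wedge_dual: "double_boolean_signature.wedge (\<sqinter>) neg = (\<curlyvee>)"
  by (simp add: fun_eq_iff vee_def double_boolean_signature.wedge_def)

lemma meet_part_dual: "double_boolean_signature.meet_part (\<squnion>) = join_part"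
  by (simp add: fun_eq_iff join_part_def double_boolean_signature.meet_part_def)

lemma join_part_dual: "double_boolean_signature.join_part (\<sqinter>) = meet_part"
  by (simp add: fun_eq_iff meet_part_def double_boolean_signature.join_part_def)

end

lemma (in double_boolean_algebra) double_boolean_algebra_dual:
  "double_boolean_algebra (\<sqinter>) (\<squnion>) opp neg Bot Top"
  by unfold_locales
    (unfold vee_dual wedge_dual,
      (fact join_idem_left join_commute join_assoc opp_join_idem join_meet_absorb
        join_wedge_distrib join_wedge_absorb opp_opp_join join_opp opp_Top opp_Bot
        meet_idem_left meet_commute meet_assoc neg_meet_idem meet_join_absorb
        meet_vee_distrib meet_vee_absorb neg_neg_meet meet_neg neg_Bot neg_Top
        meet_join_idem[symmetric])+)

context double_boolean_algebra
begin

interpretation dual: double_boolean_algebra "(\<sqinter>)" "(\<squnion>)" opp neg Bot Top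
  rewrites "double_boolean_signature.vee (\<squnion>) opp = (\<curlywedge>)"
    and "double_boolean_signature.meet_part (\<squnion>) = join_part"
    and "double_boolean_signature.join_part (\<sqinter>) = meet_part"
  by (rule double_boolean_algebra_dual vee_dual meet_part_dual join_part_dual)+

lemma opp_opp: "opp (opp x) = join_part x"
  by (fact dual.neg_neg)

lemma join_Bot: "x \<squnion> Bot = join_part x"
  by (fact dual.meet_Top)

lemma meet_part_wedge: "meet_part (x \<curlywedge> y) = join_part x \<sqinter> join_part y"
  by (fact dual.join_part_vee)

lemma qle_iff_parts: "x \<sqsubseteq> y \<longleftrightarrow> x \<sqinter> y = meet_part x \<and> y \<squnion> x = join_part y"
  by (simp add: qle_def meet_part_def join_part_def join_commute)

lemma qle_trans: "x \<sqsubseteq> y \<Longrightarrow> y \<sqsubseteq> z \<Longrightarrow> x \<sqsubseteq> z"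
  unfolding qle_iff_parts using meet_eq_meet_part_trans dual.meet_eq_meet_part_trans by blast

lemma qle_antisym_iff:
  "x \<sqsubseteq> y \<and> y \<sqsubseteq> x \<longleftrightarrow> meet_part x = meet_part y \<and> join_part x = join_part y"
  unfolding qle_iff_parts
  using meet_eq_meet_part_antisym_iff[of x y] dual.meet_eq_meet_part_antisym_iff[of x y] by blast

lemma preorder_on_qle: "preorder_on UNIV {(x, y). x \<sqsubseteq> y}"
  unfolding preorder_on_def
  by (auto intro!: refl_onI transI intro: qle_trans) (simp add: qle_def)

lemma partial_order_on_qle_iff_inj_parts:
  "partial_order_on UNIV {(x, y). x \<sqsubseteq> y} \<longleftrightarrow> inj (\<lambda>x. (meet_part x, join_part x))"
  using qle_antisym_iff by (auto simp: partial_order_on_def preorder_on_qle antisym_def inj_def)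

end

locale idempotent_double_boolean_algebra = double_boolean_algebra +
  assumes meet_idem: "x \<sqinter> x = x"
    and join_idem: "x \<squnion> x = x"
begin

lemma meet_part_eq: "meet_part x = x"
  by (simp add: meet_part_def meet_idem)

lemma join_part_eq: "join_part x = x"
  by (simp add: join_part_def join_idem)

lemma vee_eq_join: "x \<curlyvee> y = x \<squnion> y"
  using join_part_vee[of x y] by (simp only: meet_part_eq join_part_eq)

lemma wedge_eq_meet: "x \<curlywedge> y = x \<sqinter> y"
  using meet_part_wedge[of x y] by (simp only: meet_part_eq join_part_eq)

sublocale pure_double_boolean_algebra
  by unfold_locales (simp add: meet_part_eq)

sublocale fully_contextual_double_boolean_algebra
proof
  show "partial_order_on UNIV {(x, y). x \<sqsubseteq> y}"
    by (simp add: partial_order_on_qle_iff_inj_parts meet_part_eq inj_def)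
  show "\<exists>!z. meet_part z = y \<and> join_part z = x" if "join_part y = meet_part x" for x y
    using that by (simp add: meet_part_eq join_part_eq)
qed

lemma join_neg: "x \<squnion> neg x = Top"
proof -
  have "x \<curlyvee> neg x = neg Bot"
    by (simp add: vee_def meet_neg)
  then show ?thesis
    by (simp add: vee_eq_join neg_Bot meet_idem)
qed

lemma abstract_boolean_algebra: "abstract_boolean_algebra (\<sqinter>) (\<squnion>) neg Bot Top"
proof
  show "x \<sqinter> (y \<squnion> z) = x \<sqinter> y \<squnion> x \<sqinter> z" for x y z
    using meet_vee_distrib by (simp only: vee_eq_join)
  show "x \<squnion> (y \<sqinter> z) = (x \<squnion> y) \<sqinter> (x \<squnion> z)" for x y z
    using join_wedge_distrib by (simp only: wedge_eq_meet)
  show "x \<sqinter> Top = x" and "x \<squnion> Bot = x" for x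
    by (simp_all add: meet_Top join_Bot meet_part_eq join_part_eq)
qed (fact meet_assoc[symmetric] join_assoc[symmetric] meet_commute join_commute
    meet_neg join_neg)+

end

lemma (in double_boolean_algebra) idempotent_iff_negations_involutive:
  "idempotent_double_boolean_algebra (\<squnion>) (\<sqinter>) neg opp Top Bot \<longleftrightarrow>
    (\<forall>x. neg (neg x) = x) \<and> (\<forall>x. opp (opp x) = x)"
  unfolding idempotent_double_boolean_algebra_def idempotent_double_boolean_algebra_axioms_def
  by (simp add: double_boolean_algebra_axioms neg_neg opp_opp meet_part_def join_part_def)

context abstract_boolean_algebra
begin

lemma abstract_boolean_algebra_dual: "abstract_boolean_algebra (\<^bold>\<squnion>) (\<^bold>\<sqinter>) compl \<^bold>1 \<^bold>0"
  by unfold_locales (fact disj_conj_distrib conj_disj_distrib | simp)+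

lemma conj_disj_absorb: "x \<^bold>\<sqinter> (x \<^bold>\<squnion> y) = x"
proof -
  have "x \<^bold>\<sqinter> (x \<^bold>\<squnion> y) = (x \<^bold>\<squnion> \<^bold>0) \<^bold>\<sqinter> (x \<^bold>\<squnion> y)"
    by simp
  also have "\<dots> = x \<^bold>\<squnion> (\<^bold>0 \<^bold>\<sqinter> y)"
    by (simp only: disj_conj_distrib)
  finally show ?thesis
    by simp
qed

lemma disj_conj_absorb: "x \<^bold>\<squnion> (x \<^bold>\<sqinter> y) = x"
  using abstract_boolean_algebra_dual by (rule abstract_boolean_algebra.conj_disj_absorb)

lemma idempotent_double_boolean_algebra:
  "idempotent_double_boolean_algebra (\<^bold>\<squnion>) (\<^bold>\<sqinter>) compl compl \<^bold>1 \<^bold>0"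
proof -
  have vee: "double_boolean_signature.vee (\<^bold>\<sqinter>) compl = (\<^bold>\<squnion>)"
    by (simp add: fun_eq_iff double_boolean_signature.vee_def)
  have wedge: "double_boolean_signature.wedge (\<^bold>\<squnion>) compl = (\<^bold>\<sqinter>)"
    by (simp add: fun_eq_iff double_boolean_signature.wedge_def)
  show ?thesis
    by unfold_locales
      (simp_all only: vee wedge conj.idem disj.idem conj_disj_absorb disj_conj_absorb
        double_compl compl_zero compl_one conj_cancel_right disj_cancel_right,
        (fact conj.commute conj.assoc[symmetric] conj_disj_distrib
          disj.commute disj.assoc[symmetric] disj_conj_distrib)+)
qed

end

theorem mainTheorem12:
  fixes join meet :: "'a \<Rightarrow> 'a \<Rightarrow> 'a"
    and neg opp :: "'a \<Rightarrow> 'a"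
    and Top Bot :: "'a"
  shows "(abstract_boolean_algebra meet join neg Bot Top \<longrightarrow>
            double_boolean_algebra join meet neg neg Top Bot \<and>
            fully_contextual_double_boolean_algebra join meet neg neg Top Bot \<and>
            pure_double_boolean_algebra join meet neg neg Top Bot) \<and>
         (double_boolean_algebra join meet neg opp Top Bot \<and>
            (\<forall>a. neg a = opp a) \<and> (\<forall>a. neg (neg a) = a) \<longrightarrow>
            abstract_boolean_algebra meet join neg Bot Top)"
proof (rule conjI; rule impI)
  assume "abstract_boolean_algebra meet join neg Bot Top"
  then interpret idempotent_double_boolean_algebra join meet neg neg Top Bot
    by (rule abstract_boolean_algebra.idempotent_double_boolean_algebra)
  show "double_boolean_algebra join meet neg neg Top Bot \<and>
      fully_contextual_double_boolean_algebra join meet neg neg Top Bot \<and>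
      pure_double_boolean_algebra join meet neg neg Top Bot"
    by (intro conjI) unfold_locales
next
  assume involutive: "double_boolean_algebra join meet neg opp Top Bot \<and>
    (\<forall>a. neg a = opp a) \<and> (\<forall>a. neg (neg a) = a)"
  then interpret double_boolean_algebra join meet neg opp Top Bot
    by simp
  have "idempotent_double_boolean_algebra join meet neg opp Top Bot"
    using involutive by (metis idempotent_iff_negations_involutive)
  then show "abstract_boolean_algebra meet join neg Bot Top"
    by (rule idempotent_double_boolean_algebra.abstract_boolean_algebra)
qed

end
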